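(* Let $G$ be a finite graph on vertex set $V$, and let $V = V_1 \sqcup V_2 \sqcup \dots \sqcup V_m$ be a partition of $V$. Suppose there are integers $q \ge 2$, $n \ge m+1$, and $k_1, \dots, k_m \ge 1$ with $|V_j| = qk_j - 1$ for all $j$ and $|V| = (q-1)n+1$. Suppose furthermore that for every continuous map $F\colon \mathrm{I}(G) \to \mathbb{R}^{n-1}$ there are $q$ pairwise disjoint faces $S_1, \dots, S_q$ of $\mathrm{I}(G)$ with $F(S_1) \cap \dots \cap F(S_q) \neq \emptyset$. Then $G$ admits a balanced almost fair splitting by $q$ independent sets.
   Context: A set of vertices is independent if it contains no two endpoints of an edge. The independence complex $\mathrm{I}(G)$ is the simplicial complex whose faces are the independent sets of $G$; it is regarded as a topological space via its geometric realization (the face $\sigma$ realized as the convex hull of the standard basis vectors $e_v$, $v \in \sigma$, in $\mathbb{R}^V$), and $F(S)$ denotes the image of the realized face $S$. Given a partition $V_1 \sqcup \dots \sqcup V_m$ of $V$, pairwise disjoint sets $S_1, \dots, S_q \subseteq V$ form an almost fair splitting if $|S_i \cap V_j| \ge \lfloor \frac{|V_j|+1}{q} \rfloor - 1$ for all $i,j$ and $|V_j \setminus \bigcup_i S_i| \le q-1$ for all $j$. The splitting is balanced if the cardinalities $|S_1|, \dots, |S_q|$ pairwise differ by at most one. *)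

theory Defs
  imports "HOL-Analysis.Analysis" "HOL-Library.Ramsey"
begin

text \<open>
  A finite graph is given by a finite vertex type and a set of edges, each edge being a two-element
  set of vertices; the vertex set is \<open>UNIV\<close>. Independence of a set is \<open>indep\<close> from Ramsey.
\<close>

definition independence_complex :: "'v set set \<Rightarrow> 'v set set" where
  "independence_complex E = {S. indep S E}"

definition realized_face :: "'v::finite set \<Rightarrow> (real ^ 'v) set" where
  "realized_face S = convex hull ((\<lambda>v. axis v 1) ` S)"

definition geometric_realization :: "'v::finite set set \<Rightarrow> (real ^ 'v) set" where
  "geometric_realization K = (\<Union>S\<in>K. realized_face S)"

definition almost_fair_splitting ::
  "nat \<Rightarrow> (nat \<Rightarrow> 'v set) \<Rightarrow> nat \<Rightarrow> (nat \<Rightarrow> 'v set) \<Rightarrow> bool" where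
  "almost_fair_splitting m V q S \<longleftrightarrow>
     disjoint_family_on S {1..q} \<and>
     (\<forall>i\<in>{1..q}. \<forall>j\<in>{1..m}.
        int (card (S i \<inter> V j)) \<ge> \<lfloor>(real (card (V j)) + 1) / real q\<rfloor> - 1) \<and>
     (\<forall>j\<in>{1..m}. int (card (V j - (\<Union>i\<in>{1..q}. S i))) \<le> int q - 1)"

definition balanced_splitting :: "nat \<Rightarrow> (nat \<Rightarrow> 'v set) \<Rightarrow> bool" where
  "balanced_splitting q S \<longleftrightarrow>
     (\<forall>i\<in>{1..q}. \<forall>i'\<in>{1..q}. \<bar>int (card (S i)) - int (card (S i'))\<bar> \<le> 1)"

end

theory Submission
  imports Defs
begin

text \<open>
  Map \<open>x\<close> to the \<open>m\<close> elementary symmetric polynomials of degree \<open>k j\<close> in the weights on \<open>V j\<close>, followed by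
  the moments \<open>\<Sum>v. x v * t v ^ c\<close> with \<open>0 < c < n - m\<close>.  At a Tverberg \<open>q\<close>-fold point let \<open>S i\<close> be the
  supports of the preimages.  Since \<open>card (V j) < q * k j\<close>, some \<open>S i\<close> has fewer than \<open>k j\<close> vertices in
  \<open>V j\<close>, so the \<open>j\<close>-th symmetric polynomial vanishes at one preimage, hence at all of them, and every \<open>S i\<close>
  has at most \<open>k j - 1\<close> vertices in \<open>V j\<close>.  If the \<open>t v\<close> are generic, the points \<open>(1, t v, \<dots>, t v ^ (n - m - 1))\<close>
  on the moment curve are in strong general position, and coinciding moments force the supports to
  have at least \<open>(q - 1) * (n - m) + 1\<close> vertices in total.  This is exactly the sum of the upper
  bounds \<open>k j - 1\<close>, so all of them are attained.
\<close>

section \<open>Strong general position of generic points on a curve\<close>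

text \<open>If \<open>p\<close> lies outside the sum of \<open>B\<close> and \<open>span X\<close>,
  an element of \<open>B\<close> with nonzero \<open>p\<close>-coefficient could be solved for
  \<open>p\<close>, so the intersection does not grow. Otherwise \<open>generic\<close> makes the
  sum all of \<open>U\<close>, and the dimension formula for sums of subspaces gives the
  equality.\<close>

lemma dim_Int_span_insert:
  fixes B X :: "'a::euclidean_space set"
  assumes B: "subspace B" "B \<subseteq> U" and U: "subspace U" and X: "X \<subseteq> U" "p \<in> U"
    and generic: "p \<in> {x + y |x y. x \<in> B \<and> y \<in> span X} \<Longrightarrow>
      {x + y |x y. x \<in> B \<and> y \<in> span X} = U"
  shows "B \<inter> span (insert p X) = B \<inter> span X \<or>
    dim (B \<inter> span (insert p X)) + dim U = dim B + dim (span (insert p X))"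
proof (cases "p \<in> {x + y |x y. x \<in> B \<and> y \<in> span X}")
  case True
  have "span (insert p X) \<subseteq> U"
    using X U by (simp add: span_minimal)
  then have "{x + y |x y. x \<in> B \<and> y \<in> span (insert p X)} \<subseteq> U"
    using B U by (auto intro: subspace_add)
  moreover have "U \<subseteq> {x + y |x y. x \<in> B \<and> y \<in> span (insert p X)}"
    using generic[OF True] span_mono[OF subset_insertI, of X p] by blast
  ultimately have "{x + y |x y. x \<in> B \<and> y \<in> span (insert p X)} = U"
    by blast
  then show ?thesis
    using dim_sums_Int[OF B(1) subspace_span, of "insert p X"] by simp
next
  case False
  have "x \<in> span X" if x: "x \<in> B" "x \<in> span (insert p X)" for x
  proof -
    obtain c where c: "x - c *\<^sub>R p \<in> span X"
      using x(2) span_breakdown_eq by blast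
    show ?thesis
    proof (cases "c = 0")
      case False
      have "p = (1/c) *\<^sub>R x + - ((1/c) *\<^sub>R (x - c *\<^sub>R p))"
        using False by (simp add: algebra_simps)
      moreover have "(1/c) *\<^sub>R x \<in> B" "- ((1/c) *\<^sub>R (x - c *\<^sub>R p)) \<in> span X"
        using x B c by (auto intro: subspace_scale span_neg span_scale)
      ultimately show ?thesis
        using \<open>p \<notin> _\<close> by blast
    qed (use c in simp)
  qed
  then show ?thesis
    using span_mono[OF subset_insertI, of X p] by blast
qed

text \<open>
  Spans of disjoint families meet in at most the dimension that codimension counting predicts.  The first
  disjunct covers a negative expected dimension, and intersecting with \<open>U\<close> makes sense of \<open>I = {}\<close>.
\<close>

definition strong_general_position :: "'a::euclidean_space set \<Rightarrow> ('b \<Rightarrow> 'a) \<Rightarrow> 'b set \<Rightarrow> bool" where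
  "strong_general_position U p A \<longleftrightarrow> (\<forall>I (S :: nat \<Rightarrow> 'b set).
    finite I \<longrightarrow> disjoint_family_on S I \<longrightarrow> (\<forall>i\<in>I. S i \<subseteq> A) \<longrightarrow>
    dim (U \<inter> (\<Inter>i\<in>I. span (p ` S i))) = 0 \<or>
    dim (U \<inter> (\<Inter>i\<in>I. span (p ` S i))) + card I * dim U \<le> (\<Sum>i\<in>I. card (S i)) + dim U)"

text \<open>The points are chosen one by one. A new point only has to avoid finitely many proper
  subspaces of \<open>U\<close>, and by \<open>fin\<close> each of them excludes finitely many
  parameters.\<close>

lemma exists_strong_general_position:
  fixes \<gamma> :: "real \<Rightarrow> 'a::euclidean_space" and A :: "'b set"
  assumes "finite A" and U: "subspace U" and \<gamma>: "\<And>t. \<gamma> t \<in> U"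
    and fin: "\<And>W. subspace W \<Longrightarrow> W \<subset> U \<Longrightarrow> finite {t. \<gamma> t \<in> W}"
  shows "\<exists>t. strong_general_position U (\<lambda>v. \<gamma> (t v)) A"
  using \<open>finite A\<close>
proof (induction A rule: finite_induct)
  case empty
  have "dim (U \<inter> (\<Inter>i\<in>I. span ((\<lambda>v. \<gamma> (0::real)) ` S i))) = 0 \<or>
    dim (U \<inter> (\<Inter>i\<in>I. span ((\<lambda>v. \<gamma> 0) ` S i))) + card I * dim U \<le> (\<Sum>i\<in>I. card (S i)) + dim U"
    if "\<forall>i\<in>I. S i \<subseteq> {}" for I :: "nat set" and S :: "nat \<Rightarrow> 'b set"
  proof (cases "I = {}")
    case False
    then have "(\<Inter>i\<in>I. span ((\<lambda>v. \<gamma> 0) ` S i)) \<subseteq> {0}"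
      using that by fastforce
    then show ?thesis by auto
  qed simp
  then show ?case
    unfolding strong_general_position_def by (intro exI[of _ "\<lambda>_. 0"]) simp
next
  case (insert v A)
  define Q where "Q t I S \<longleftrightarrow> dim (U \<inter> (\<Inter>i\<in>I. span ((\<lambda>v. \<gamma> (t v)) ` S i))) = 0 \<or>
    dim (U \<inter> (\<Inter>i\<in>I. span ((\<lambda>v. \<gamma> (t v)) ` S i))) + card I * dim U \<le> (\<Sum>i\<in>I. card (S i)) + dim U"
    for t :: "'b \<Rightarrow> real" and I and S :: "nat \<Rightarrow> 'b set"
  have Q: "strong_general_position U (\<lambda>v. \<gamma> (t v)) A \<longleftrightarrow>
    (\<forall>I S. finite I \<longrightarrow> disjoint_family_on S I \<longrightarrow> (\<forall>i\<in>I. S i \<subseteq> A) \<longrightarrow> Q t I S)" for t A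
    unfolding strong_general_position_def Q_def by (rule refl)
  obtain t where sgp: "strong_general_position U (\<lambda>v. \<gamma> (t v)) A"
    using insert.IH by blast
  have t: "Q t I S" if "finite I" "disjoint_family_on S I" "\<And>i. i\<in>I \<Longrightarrow> S i \<subseteq> A" for I S
    using sgp that unfolding Q by simp
  define sp where "sp X = span ((\<lambda>v. \<gamma> (t v)) ` X)" for X
  define sum_space where "sum_space \<X> X = {x + y |x y. x \<in> U \<inter> (\<Inter>Y\<in>\<X>. sp Y) \<and> y \<in> sp X}" for \<X> X
  \<comment> \<open>There are infinitely many pairs \<open>I\<close>, \<open>S\<close>, but an
    intersection of spans depends only on the collection of sets involved. Ranging over collections
    of subsets of \<open>A\<close> keeps \<open>bad\<close> finite.\<close>
  define bad where "bad = (\<Union>(\<X>, X) \<in> {(\<X>, X) \<in> Pow (Pow A) \<times> Pow A. sum_space \<X> X \<noteq> U}. {t. \<gamma> t \<in> sum_space \<X> X})"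
  have sub_sp: "sp X \<subseteq> U" for X
    unfolding sp_def using \<gamma> U by (intro span_minimal) auto
  have sub_B: "subspace (U \<inter> (\<Inter>Y\<in>\<X>. sp Y))" for \<X>
    using U by (intro subspace_Int subspace_inter) (auto simp: sp_def intro!: subspace_Inter)
  have "subspace (sum_space \<X> X)" for \<X> X
    unfolding sum_space_def using sub_B by (intro subspace_sums) (auto simp: sp_def)
  moreover have sum_space_sub: "sum_space \<X> X \<subseteq> U" for \<X> X
    unfolding sum_space_def using sub_sp U by (auto intro: subspace_add)
  ultimately have "finite {t. \<gamma> t \<in> sum_space \<X> X}" if "sum_space \<X> X \<noteq> U" for \<X> X
    using fin that by (metis psubsetI)
  then have "finite bad"
    unfolding bad_def using \<open>finite A\<close> 
    by (intro finite_UN_I finite_subset[OF _ finite_cartesian_product[of "Pow (Pow A)" "Pow A"]]) auto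
  then obtain s where s: "s \<notin> bad"
    using ex_new_if_finite infinite_UNIV_char_0 by blast
  define t' where "t' = t(v := s)"
  have sp': "span ((\<lambda>v. \<gamma> (t' v)) ` X) = sp X" if "v \<notin> X" for X
    unfolding sp_def t'_def using that by (intro arg_cong[where f=span] image_cong) auto
  have "Q t' I S" if I: "finite I" and dis: "disjoint_family_on S I" and SA: "\<And>i. i \<in> I \<Longrightarrow> S i \<subseteq> insert v A" for I S
  proof (cases "\<exists>i\<in>I. v \<in> S i")
    case False
    then have "(\<Inter>i\<in>I. span ((\<lambda>v. \<gamma> (t' v)) ` S i)) = (\<Inter>i\<in>I. span ((\<lambda>v. \<gamma> (t v)) ` S i))"
      using sp' unfolding sp_def by (intro INF_cong) auto
    moreover have "Q t I S"
      using False SA I dis by (intro t) auto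
    ultimately show ?thesis
      unfolding Q_def by simp
  next
    case True
    then obtain j where j: "j \<in> I" "v \<in> S j" by blast
    \<comment> \<open>By disjointness \<open>v\<close> lies in no other \<open>S i\<close>, so only
      the \<open>j\<close>-th span changes.\<close>
    define J where "J = I - {j}"
    define T where "T = S j - {v}"
    define B where "B = U \<inter> (\<Inter>i\<in>J. sp (S i))"
    have J: "I = insert j J" "j \<notin> J" "finite J"
      using j I by (auto simp: J_def)
    have vJ: "v \<notin> S i" if "i \<in> J" for i
      using that j dis unfolding J_def disjoint_family_on_def by auto
    have Sj: "S j = insert v T" "v \<notin> T"
      using j by (auto simp: T_def)
    have SJ: "S i \<subseteq> A" if "i \<in> J" for i
      using vJ[OF that] SA that J by blast
    have T: "T \<subseteq> A"
      using SA[OF j(1)] by (auto simp: T_def)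
    have finT: "finite T"
      using T \<open>finite A\<close> finite_subset by blast
    have spj: "span ((\<lambda>v. \<gamma> (t' v)) ` S j) = span (insert (\<gamma> s) ((\<lambda>v. \<gamma> (t v)) ` T))"
      unfolding Sj(1) using Sj(2) by (intro arg_cong[where f=span]) (auto simp: t'_def image_iff)
    have new: "U \<inter> (\<Inter>i\<in>I. span ((\<lambda>v. \<gamma> (t' v)) ` S i)) = B \<inter> span (insert (\<gamma> s) ((\<lambda>v. \<gamma> (t v)) ` T))"
      unfolding J(1) B_def using sp' vJ spj by auto
    have Beq: "B = U \<inter> (\<Inter>Y\<in>S ` J. sp Y)"
      by (auto simp: B_def)
    have sum_space: "sum_space (S ` J) T = {x + y |x y. x \<in> B \<and> y \<in> span ((\<lambda>v. \<gamma> (t v)) ` T)}"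
      unfolding sum_space_def Beq sp_def by (rule refl)
    have "sum_space (S ` J) T = U" if "\<gamma> s \<in> sum_space (S ` J) T"
    proof (rule ccontr)
      assume "sum_space (S ` J) T \<noteq> U"
      then have "(S ` J, T) \<in> {(\<X>, X) \<in> Pow (Pow A) \<times> Pow A. sum_space \<X> X \<noteq> U}"
        using SJ T by auto
      then have "s \<in> bad"
        unfolding bad_def using that by (intro UN_I[of "(S ` J, T)"]) simp_all
      with s show False ..
    qed
    note gen = this[unfolded sum_space]
    have card_I: "card I = Suc (card J)" and sum_I: "(\<Sum>i\<in>I. card (S i)) = Suc (card T) + (\<Sum>i\<in>J. card (S i))"
      using J Sj finT by auto
    have "subspace B"
      unfolding Beq by (rule sub_B)
    then consider (same) "B \<inter> span (insert (\<gamma> s) ((\<lambda>v. \<gamma> (t v)) ` T)) = B \<inter> sp T" 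
      | (grow) "dim (B \<inter> span (insert (\<gamma> s) ((\<lambda>v. \<gamma> (t v)) ` T))) + dim U =
          dim B + dim (span (insert (\<gamma> s) ((\<lambda>v. \<gamma> (t v)) ` T)))"
      using dim_Int_span_insert[of B U "(\<lambda>v. \<gamma> (t v)) ` T" "\<gamma> s"] U \<gamma> gen
      unfolding sp_def B_def by blast
    then show ?thesis
    proof cases
      \<comment> \<open>The new point contributes nothing, so the bound for \<open>S(j := T)\<close>
        carries over with one vertex to spare.\<close>
      case same
      have "Q t I (S(j := T))"
        using I dis SJ T J(1) by (intro t) (auto simp: disjoint_family_on_def T_def)
      moreover have "U \<inter> (\<Inter>i\<in>I. span ((\<lambda>v. \<gamma> (t v)) ` (S(j := T)) i)) = B \<inter> sp T"
      proof -
        have "(\<Inter>i\<in>J. span ((\<lambda>v. \<gamma> (t v)) ` (S(j := T)) i)) = (\<Inter>i\<in>J. sp (S i))"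
          unfolding sp_def using J(2) by (intro INF_cong) auto
        then show ?thesis
          unfolding J(1) B_def by (simp add: sp_def Int_ac)
      qed
      moreover have "(\<Sum>i\<in>I. card ((S(j := T)) i)) = card T + (\<Sum>i\<in>J. card (S i))"
        unfolding J(1) using J(2,3) by (auto intro: sum.cong)
      ultimately show ?thesis
        unfolding Q_def new same sum_I by auto
    next
      \<comment> \<open>The induction hypothesis bounds \<open>dim B\<close>, and the
        \<open>j\<close>-th span, of dimension at most \<open>Suc (card T)\<close>, cuts
        \<open>B\<close> in the expected codimension. If \<open>dim B = 0\<close>, the first
        alternative persists.\<close>
      case grow
      have "Q t J S"
        using J SJ dis by (intro t) (auto simp: disjoint_family_on_def)
      then have "dim B = 0 \<or> dim B + card J * dim U \<le> (\<Sum>i\<in>J. card (S i)) + dim U"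
        unfolding Q_def B_def sp_def .
      moreover have "dim (B \<inter> span (insert (\<gamma> s) ((\<lambda>v. \<gamma> (t v)) ` T))) \<le> dim B"
        by (intro dim_subset) auto
      moreover have "dim (span (insert (\<gamma> s) ((\<lambda>v. \<gamma> (t v)) ` T))) \<le> Suc (card T)"
        using finT by (intro order.trans[OF dim_le_card[OF order.refl]] order.trans[OF card_insert_le_m1])
          (auto intro: card_image_le order.trans[OF card_insert_le_m1])
      ultimately show ?thesis
        unfolding Q_def new sum_I card_I using grow by auto
    qed
  qed
  then have "strong_general_position U (\<lambda>v. \<gamma> (t' v)) (insert v A)"
    unfolding Q by simp
  then show ?case by blast
qed

text \<open>A nonzero \<open>a\<close> in the span of the \<open>e c\<close> and orthogonal to
  \<open>W\<close> pairs with the curve to a polynomial in \<open>t\<close> that vanishes whenever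
  the curve is in \<open>W\<close>. The polynomial is nonzero because \<open>a\<close> cannot be
  orthogonal to every \<open>e c\<close>.\<close>

lemma finite_power_curve_in_subspace:
  fixes e :: "nat \<Rightarrow> 'a::euclidean_space"
  assumes W: "subspace W" "W \<subset> span (e ` {..<D})"
  shows "finite {t::real. (\<Sum>c<D. t ^ c *\<^sub>R e c) \<in> W}"
proof -
  have "span W \<subset> span (e ` {..<D})"
    using W by (simp add: span_eq_iff[THEN iffD2])
  then obtain a where a: "a \<noteq> 0" "a \<in> span (e ` {..<D})" "\<And>y. y \<in> span W \<Longrightarrow> orthogonal a y"
    using orthogonal_to_subspace_exists_gen by metis
  have "\<exists>c<D. a \<bullet> e c \<noteq> 0"
  proof (rule ccontr)
    assume "\<not> ?thesis"
    then have "orthogonal a y" if "y \<in> e ` {..<D}" for y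
      using that by (auto simp: orthogonal_def)
    then have "orthogonal a a"
      using a(2) orthogonal_to_span by blast
    with a(1) show False by (simp add: orthogonal_def)
  qed
  then obtain c where c: "c < D" "a \<bullet> e c \<noteq> 0" by blast
  have "finite {t::real. (\<Sum>i\<le>D - 1. (a \<bullet> e i) * t ^ i) = 0}"
    using c by (subst polyfun_finite_roots) (auto intro!: exI[of _ c])
  moreover have "(\<Sum>i\<le>D - 1. (a \<bullet> e i) * t ^ i) = 0" if "(\<Sum>c<D. t ^ c *\<^sub>R e c) \<in> W" for t
  proof -
    have "a \<bullet> (\<Sum>c<D. t ^ c *\<^sub>R e c) = 0"
      using a(3)[OF span_base[OF that]] by (simp add: orthogonal_def)
    moreover have "{..D - 1} = {..<D}"
      using c by auto
    ultimately show ?thesis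
      by (simp add: inner_sum_right mult.commute)
  qed
  ultimately show ?thesis
    by (auto elim: finite_subset[rotated])
qed

section \<open>Weights on faces and elementary symmetric polynomials\<close>

lemma realized_face_weights:
  assumes "x \<in> realized_face S"
  shows "(\<forall>v. 0 \<le> x $ v) \<and> (\<Sum>v\<in>UNIV. x $ v) = 1 \<and> {v. x $ v \<noteq> 0} \<subseteq> S"
proof -
  let ?C = "{x :: real ^ 'a. (\<forall>v. 0 \<le> x $ v) \<and> (\<Sum>v\<in>UNIV. x $ v) = 1 \<and> (\<forall>v. v \<notin> S \<longrightarrow> x $ v = 0)}"
  have "convex ?C"
    by (auto simp: convex_def sum.distrib simp flip: sum_distrib_left)
  moreover have "(\<lambda>v. axis v 1) ` S \<subseteq> ?C"
    by (auto simp: axis_def)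
  ultimately have "realized_face S \<subseteq> ?C"
    unfolding realized_face_def by (rule hull_minimal[rotated])
  with assms show ?thesis by blast
qed

text \<open>All terms are nonnegative, so the sum vanishes iff no \<open>k\<close>-subset of
  \<open>X\<close> lies in the support of \<open>x\<close>. Thus a single real coordinate detects
  small supports.\<close>

lemma elementary_symmetric_eq_0_iff:
  fixes x :: "'b \<Rightarrow> real"
  assumes "finite X" "\<And>v. 0 \<le> x v"
  shows "(\<Sum>T | T \<subseteq> X \<and> card T = k. \<Prod>v\<in>T. x v) = 0 \<longleftrightarrow> card {v \<in> X. x v \<noteq> 0} < k"
proof -
  have fin: "finite {T. T \<subseteq> X \<and> card T = k}"
    using assms(1) by simp
  have "(\<Sum>T | T \<subseteq> X \<and> card T = k. \<Prod>v\<in>T. x v) = 0 \<longleftrightarrow>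
      (\<forall>T. T \<subseteq> X \<and> card T = k \<longrightarrow> (\<Prod>v\<in>T. x v) = 0)"
    using assms(2) by (subst sum_nonneg_eq_0_iff[OF fin]) (auto intro: prod_nonneg)
  also have "\<dots> \<longleftrightarrow> \<not> (\<exists>T \<subseteq> {v \<in> X. x v \<noteq> 0}. card T = k)"
  proof -
    have "(\<Prod>v\<in>T. x v) = 0 \<longleftrightarrow> \<not> T \<subseteq> {v \<in> X. x v \<noteq> 0}" if "T \<subseteq> X" for T
      using that finite_subset[OF that assms(1)] by (auto simp: prod_zero_iff)
    then show ?thesis by blast
  qed
  also have "\<dots> \<longleftrightarrow> card {v \<in> X. x v \<noteq> 0} < k"
  proof -
    define Y where "Y = {v \<in> X. x v \<noteq> 0}"
    have "finite Y"
      using assms(1) by (simp add: Y_def)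
    then have "(\<exists>T \<subseteq> Y. card T = k) \<longleftrightarrow> k \<le> card Y"
      by (meson card_mono obtain_subset_with_card_n)
    then show ?thesis
      unfolding Y_def by (simp only: not_le)
  qed
  finally show ?thesis .
qed

section \<open>Coinciding moments force large supports\<close>

text \<open>Equal moments of degree below \<open>D\<close> mean that the combinations of curve
  points with weights \<open>x i\<close> coincide. Their common value lies in every span and is
  nonzero because the weights sum to 1, which excludes the zero alternative of
  \<open>strong_general_position\<close>.\<close>

lemma exists_moments_strong_general_position:
  assumes D: "0 < D" "D \<le> CARD('v::finite)"
  shows "\<exists>t :: 'v \<Rightarrow> real. \<forall>I (x :: nat \<Rightarrow> real ^ 'v). finite I \<longrightarrow> I \<noteq> {} \<longrightarrow>
      disjoint_family_on (\<lambda>i. {v. x i $ v \<noteq> 0}) I \<longrightarrow>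
      (\<forall>i\<in>I. (\<Sum>v\<in>UNIV. x i $ v) = 1) \<longrightarrow>
      (\<forall>c<D. \<forall>i\<in>I. \<forall>j\<in>I. (\<Sum>v\<in>UNIV. x i $ v * t v ^ c) = (\<Sum>v\<in>UNIV. x j $ v * t v ^ c)) \<longrightarrow>
      (card I - 1) * D + 1 \<le> (\<Sum>i\<in>I. card {v. x i $ v \<noteq> 0})"
proof -
  \<comment> \<open>The curve is placed in \<open>D\<close> coordinate directions of
    \<open>real ^ 'v\<close>, which makes \<open>U\<close> a space of dimension
    \<open>D\<close>.\<close>
  obtain b :: "nat \<Rightarrow> 'v" where b: "inj_on b {..<D}"
    using D by (metis card_le_inj card_lessThan finite finite_lessThan)
  define e :: "nat \<Rightarrow> real ^ 'v" where "e c = axis (b c) 1" for c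
  define U where "U = span (e ` {..<D})"
  define \<gamma> where "\<gamma> t = (\<Sum>c<D. t ^ c *\<^sub>R e c)" for t :: real
  have "inj_on e {..<D}"
    using b by (auto simp: inj_on_def e_def axis_eq_axis)
  moreover have "independent (e ` {..<D})"
    by (rule independent_mono[OF independent_Basis]) (auto simp: e_def axis_in_Basis_iff)
  ultimately have dimU: "dim U = D"
    unfolding U_def by (simp add: dim_span_eq_card_independent card_image del: dim_span)
  have U: "subspace U" and \<gamma>: "\<gamma> t \<in> U" for t
    unfolding U_def \<gamma>_def by (rule subspace_span, intro span_sum span_scale span_base) auto
  have "finite {t. \<gamma> t \<in> W}" if "subspace W" "W \<subset> U" for W
    using finite_power_curve_in_subspace that unfolding U_def \<gamma>_def by blast
  from exists_strong_general_position[OF finite_class.finite_UNIV U \<gamma> this]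
  obtain t :: "'v \<Rightarrow> real" where t: "strong_general_position U (\<lambda>v. \<gamma> (t v)) UNIV"
    by blast
  have bound: "(card I - 1) * D + 1 \<le> (\<Sum>i\<in>I. card {v. x i $ v \<noteq> 0})"
    if I: "finite I" "I \<noteq> {}" and dis: "disjoint_family_on (\<lambda>i. {v. x i $ v \<noteq> 0}) I"
      and sum1: "\<And>i. i \<in> I \<Longrightarrow> (\<Sum>v\<in>UNIV. x i $ v) = 1"
      and moments: "\<And>c i j. c < D \<Longrightarrow> i \<in> I \<Longrightarrow> j \<in> I \<Longrightarrow>
        (\<Sum>v\<in>UNIV. x i $ v * t v ^ c) = (\<Sum>v\<in>UNIV. x j $ v * t v ^ c)"
    for I and x :: "nat \<Rightarrow> real ^ 'v"
  proof -
    define z where "z i = (\<Sum>v\<in>UNIV. x i $ v *\<^sub>R \<gamma> (t v))" for i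
    have z: "z i = (\<Sum>c<D. (\<Sum>v\<in>UNIV. x i $ v * t v ^ c) *\<^sub>R e c)" for i
      unfolding z_def \<gamma>_def scaleR_sum_right scaleR_sum_left
      by (subst sum.swap) simp
    have zU: "z i \<in> U" for i
      unfolding z_def using U \<gamma> by (intro subspace_sum subspace_scale)
    have zsp: "z i \<in> span ((\<lambda>v. \<gamma> (t v)) ` {v. x i $ v \<noteq> 0})" for i
      unfolding z_def
    proof (rule span_sum)
      fix v
      show "x i $ v *\<^sub>R \<gamma> (t v) \<in> span ((\<lambda>v. \<gamma> (t v)) ` {v. x i $ v \<noteq> 0})"
        by (cases "x i $ v = 0") (auto intro: span_scale span_base span_zero)
    qed
    obtain j where j: "j \<in> I" using I by blast
    have "z i = z j" if "i \<in> I" for i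
      unfolding z by (intro sum.cong refl arg_cong2[where f=scaleR] moments that j) simp
    then have "z j \<in> U \<inter> (\<Inter>i\<in>I. span ((\<lambda>v. \<gamma> (t v)) ` {v. x i $ v \<noteq> 0}))"
      using zU[of j] zsp by (auto simp del: mem_Collect_eq) metis
    moreover have "z j \<noteq> 0"
    proof -
      have "z j $ b 0 = (\<Sum>c<D. (\<Sum>v\<in>UNIV. x j $ v * t v ^ c) * e c $ b 0)"
        unfolding z by simp
      also have "\<dots> = (\<Sum>c<D. if c = 0 then 1 else 0)"
        using inj_on_eq_iff[OF b] D sum1[OF j]
        by (intro sum.cong) (auto simp: e_def axis_def)
      also have "\<dots> = 1"
        using D by simp
      finally show ?thesis by auto
    qed
    ultimately have dim0: "dim (U \<inter> (\<Inter>i\<in>I. span ((\<lambda>v. \<gamma> (t v)) ` {v. x i $ v \<noteq> 0}))) \<noteq> 0"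
      unfolding dim_eq_0 by blast
    then have "dim (U \<inter> (\<Inter>i\<in>I. span ((\<lambda>v. \<gamma> (t v)) ` {v. x i $ v \<noteq> 0}))) + card I * dim U
        \<le> (\<Sum>i\<in>I. card {v. x i $ v \<noteq> 0}) + dim U"
      using t[unfolded strong_general_position_def, rule_format, OF I(1) dis] by simp
    \<comment> \<open>A nonzero dimension is at least 1; this is the summand 1 in the bound.\<close>
    with dim0 have "1 + card I * D \<le> (\<Sum>i\<in>I. card {v. x i $ v \<noteq> 0}) + D"
      unfolding dimU by linarith
    moreover obtain r where "card I = Suc r"
      using I by (metis card_gt_0_iff gr0_implies_Suc)
    ultimately show ?thesis by simp
  qed
  show ?thesis
    by (rule exI[of _ t], intro allI impI, rule bound) (assumption | drule bspec, assumption+ | blast)+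
qed

theorem theorem1p1:
  fixes E :: "'v::finite set set"
    and V :: "nat \<Rightarrow> 'v set"
    and k :: "nat \<Rightarrow> nat"
    and m n q :: nat
  assumes graph: "E \<subseteq> [UNIV]\<^bsup>2\<^esup>"
    and partition_disjoint: "disjoint_family_on V {1..m}"
    and partition_cover: "(\<Union>j\<in>{1..m}. V j) = UNIV"
    and q: "q \<ge> 2"
    and n: "n \<ge> m + 1"
    and k: "\<forall>j\<in>{1..m}. k j \<ge> 1"
    and card_parts: "\<forall>j\<in>{1..m}. card (V j) = q * k j - 1"
    and card_vertices: "CARD('v) = (q - 1) * n + 1"
    and tverberg: "\<forall>F. continuous_map
            (top_of_set (geometric_realization (independence_complex E)))
            (Euclidean_space (n - 1)) F \<longrightarrow>
          (\<exists>S. (\<forall>i\<in>{1..q}. S i \<in> independence_complex E) \<and>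
               disjoint_family_on S {1..q} \<and>
               (\<Inter>i\<in>{1..q}. F ` realized_face (S i)) \<noteq> {})"
  shows "\<exists>S. (\<forall>i\<in>{1..q}. indep (S i) E) \<and>
             almost_fair_splitting m V q S \<and>
             balanced_splitting q S"
proof -

  \<comment> \<open>The test map and its Tverberg point\<close>
  define D where "D = n - m"
  have "1 * n \<le> (q - 1) * n"
    using q by (intro mult_le_mono1) auto
  then have D: "0 < D" "D \<le> CARD('v)"
    using n card_vertices unfolding D_def by linarith+
  obtain t :: "'v \<Rightarrow> real" where t: "\<forall>I (x :: nat \<Rightarrow> real ^ 'v). finite I \<longrightarrow> I \<noteq> {} \<longrightarrow>
      disjoint_family_on (\<lambda>i. {v. x i $ v \<noteq> 0}) I \<longrightarrow>
      (\<forall>i\<in>I. (\<Sum>v\<in>UNIV. x i $ v) = 1) \<longrightarrow>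
      (\<forall>c<D. \<forall>i\<in>I. \<forall>j\<in>I. (\<Sum>v\<in>UNIV. x i $ v * t v ^ c) = (\<Sum>v\<in>UNIV. x j $ v * t v ^ c)) \<longrightarrow>
      (card I - 1) * D + 1 \<le> (\<Sum>i\<in>I. card {v. x i $ v \<noteq> 0})"
    using exists_moments_strong_general_position[OF D] by (rule exE)
  \<comment> \<open>Parts are numbered from 1 and coordinates from 0, hence \<open>Suc i\<close>.
    Coordinates \<open>m\<close> to \<open>n - 2\<close> carry the exponents 1 to
    \<open>D - 1\<close>. Exponent 0 gives the constant 1 on realized faces; leaving it out brings
    the number of coordinates down to \<open>n - 1\<close>.\<close>
  define f :: "real ^ 'v \<Rightarrow> nat \<Rightarrow> real" where
    "f x i = (if i < m then \<Sum>T | T \<subseteq> V (Suc i) \<and> card T = k (Suc i). \<Prod>v\<in>T. x $ v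
      else \<Sum>v\<in>UNIV. x $ v * t v ^ (Suc i - m))" for x i
  \<comment> \<open>Points of \<open>Euclidean_space (n - 1)\<close> are sequences that vanish from
    index \<open>n - 1\<close> on.\<close>
  define F where "F x = (\<lambda>i. if i < n - 1 then f x i else 0)" for x
  have "continuous_on X (\<lambda>x. f x i)" for X i
    unfolding f_def by (cases "i < m") (auto intro!: continuous_intros)
  then have "continuous_map (top_of_set (geometric_realization (independence_complex E)))
      (Euclidean_space (n - 1)) F"
    unfolding F_def by (subst continuous_map_componentwise_Euclidean_space) simp
  then obtain S0 where S0': "\<forall>i\<in>{1..q}. S0 i \<in> independence_complex E"
      and dis0: "disjoint_family_on S0 {1..q}"
      and ne: "(\<Inter>i\<in>{1..q}. F ` realized_face (S0 i)) \<noteq> {}"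
    using tverberg by meson
  have S0: "indep (S0 i) E" if "i \<in> {1..q}" for i
    using S0' that by (simp add: independence_complex_def)
  obtain y where y: "y \<in> (\<Inter>i\<in>{1..q}. F ` realized_face (S0 i))"
    using ne by blast
  then have "\<forall>i\<in>{1..q}. \<exists>x. x \<in> realized_face (S0 i) \<and> F x = y"
    by blast
  then obtain x where x: "\<And>i. i \<in> {1..q} \<Longrightarrow> x i \<in> realized_face (S0 i)"
      and Fx: "\<And>i. i \<in> {1..q} \<Longrightarrow> F (x i) = y"
    by metis
  note weights = realized_face_weights[OF x]
  have f_eq: "f (x i) c = f (x j) c" if "i \<in> {1..q}" "j \<in> {1..q}" "c < n - 1" for i j c
  proof -
    have "F (x i) c = F (x j) c"
      using Fx that by simp
    then show ?thesis
      using that(3) by (simp add: F_def)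
  qed
  \<comment> \<open>A point of a face may have smaller support than the face. Passing to supports
    keeps independence and disjointness and lets values of \<open>f\<close> control
    cardinalities.\<close>
  define S where "S i = {v. x i $ v \<noteq> 0}" for i
  have S_sub: "S i \<subseteq> S0 i" if "i \<in> {1..q}" for i
    using weights[OF that] by (simp add: S_def)
  then have indep: "indep (S i) E" if "i \<in> {1..q}" for i
    using S0 that smaller_indep by blast
  have dis: "disjoint_family_on S {1..q}"
    using dis0 S_sub unfolding disjoint_family_on_def by blast
  have dis_inter: "disjoint_family_on (\<lambda>i. S i \<inter> X) {1..q}" for X
    using dis unfolding disjoint_family_on_def by blast
  have card_UN: "card (\<Union>i\<in>{1..q}. S i \<inter> X) = (\<Sum>i\<in>{1..q}. card (S i \<inter> X))" for X
    using dis_inter by (intro card_UN_disjoint') auto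

  \<comment> \<open>Upper bounds on the supports in each part\<close>
  have small: "card (S i \<inter> V j) \<le> k j - 1" if i: "i \<in> {1..q}" and j: "j \<in> {1..m}" for i j
  proof -
    have iff: "f (x i) (j - 1) = 0 \<longleftrightarrow> card (S i \<inter> V j) < k j" if "i \<in> {1..q}" for i
    proof -
      have "f (x i) (j - 1) = (\<Sum>T | T \<subseteq> V j \<and> card T = k j. \<Prod>v\<in>T. x i $ v)"
        using j by (auto simp: f_def)
      moreover have "{v \<in> V j. x i $ v \<noteq> 0} = S i \<inter> V j"
        by (auto simp: S_def)
      ultimately show ?thesis
        using elementary_symmetric_eq_0_iff[of "V j" "($) (x i)" "k j"] weights[OF that] by simp
    qed
    have "\<exists>i\<in>{1..q}. card (S i \<inter> V j) < k j"
    proof (rule ccontr)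
      assume "\<not> ?thesis"
      then have "(\<Sum>i\<in>{1..q}. k j) \<le> (\<Sum>i\<in>{1..q}. card (S i \<inter> V j))"
        by (intro sum_mono) (auto simp: not_less)
      also have "\<dots> = card (\<Union>i\<in>{1..q}. S i \<inter> V j)"
        by (rule card_UN[symmetric])
      also have "\<dots> \<le> card (V j)"
        by (intro card_mono) auto
      finally have "(\<Sum>i\<in>{1..q}. k j) \<le> q * k j - 1"
        unfolding bspec[OF card_parts j] .
      moreover have "(\<Sum>i\<in>{1..q}. k j) = q * k j"
        by simp
      moreover have "q * k j > 0"
        using q bspec[OF k j] by simp
      ultimately show False by linarith
    qed
    then obtain i' where "i' \<in> {1..q}" "f (x i') (j - 1) = 0"
      using iff by blast
    moreover have "j - 1 < n - 1"
      using j n by auto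
    ultimately have "f (x i) (j - 1) = 0"
      using f_eq i by metis
    then show ?thesis using iff[OF i] by simp
  qed

  \<comment> \<open>Lower bound on the total size and equality\<close>
  have card_S: "card (S i) = (\<Sum>j\<in>{1..m}. card (S i \<inter> V j))" for i
  proof -
    have "S i = (\<Union>j\<in>{1..m}. S i \<inter> V j)"
      using partition_cover by blast
    then show ?thesis
      using partition_disjoint card_UN_disjoint'[of "\<lambda>j. S i \<inter> V j" "{1..m}"]
      unfolding disjoint_family_on_def by fastforce
  qed
  have "(card {1..q} - 1) * D + 1 \<le> (\<Sum>i\<in>{1..q}. card {v. x i $ v \<noteq> 0})"
  proof (rule t[rule_format])
    \<comment> \<open>Exponent 0 is covered by the total weight 1, a positive exponent
      \<open>Suc c'\<close> by coordinate \<open>m + c'\<close>.\<close>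
    fix c i j assume c: "c < D" and ij: "i \<in> {1..q}" "j \<in> {1..q}"
    show "(\<Sum>v\<in>UNIV. x i $ v * t v ^ c) = (\<Sum>v\<in>UNIV. x j $ v * t v ^ c)"
    proof (cases c)
      case 0
      then show ?thesis using weights ij by simp
    next
      case (Suc c')
      then have "m + c' < n - 1" "Suc (m + c') - m = c"
        using c by (auto simp: D_def)
      then show ?thesis
        using f_eq[OF ij, of "m + c'"] by (simp add: f_def)
    qed
  qed (use q weights dis in \<open>auto simp: S_def[abs_def]\<close>)
  then have lower: "(q - 1) * D + 1 \<le> (\<Sum>i\<in>{1..q}. \<Sum>j\<in>{1..m}. card (S i \<inter> V j))"
    by (simp add: card_S flip: S_def)

  \<comment> \<open>Summing \<open>card (V j) = q * (k j - 1) + (q - 1)\<close> over the parts and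
    inserting \<open>n = D + m\<close> into the vertex count, the terms \<open>m * (q - 1)\<close>
    cancel.\<close>
  have total: "(\<Sum>i\<in>{1..q}. \<Sum>j\<in>{1..m}. k j - 1) = (q - 1) * D + 1"
  proof -
    have "(q - 1) * n + 1 = (\<Sum>j\<in>{1..m}. card (V j))"
      using card_UN_disjoint'[of V "{1..m}"] partition_disjoint partition_cover card_vertices by simp
    also have "\<dots> = (\<Sum>j\<in>{1..m}. q * (k j - 1) + (q - 1))"
    proof (rule sum.cong)
      fix j assume "j \<in> {1..m}"
      moreover from this k obtain l where "k j = Suc l"
        by (metis Suc_le_D One_nat_def)
      ultimately show "card (V j) = q * (k j - 1) + (q - 1)"
        using card_parts q by simp
    qed simp
    also have "\<dots> = q * (\<Sum>j\<in>{1..m}. k j - 1) + m * (q - 1)"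
      by (simp add: sum.distrib sum_distrib_left)
    moreover have "(q - 1) * n = (q - 1) * D + m * (q - 1)"
    proof -
      have "n = D + m"
        using n by (simp add: D_def)
      then show ?thesis
        by (simp only: distrib_left mult.commute)
    qed
    ultimately show ?thesis by simp
  qed
  have upper: "(\<Sum>j\<in>{1..m}. card (S i \<inter> V j)) \<le> (\<Sum>j\<in>{1..m}. k j - 1)" if "i \<in> {1..q}" for i
    using small that by (intro sum_mono) auto
  \<comment> \<open>The lower bound meets the sum of the upper bounds, which forces equality
    termwise, first in \<open>i\<close> and then in \<open>j\<close>.\<close>
  have eq_total: "(\<Sum>i\<in>{1..q}. \<Sum>j\<in>{1..m}. card (S i \<inter> V j)) = (\<Sum>i\<in>{1..q}. \<Sum>j\<in>{1..m}. k j - 1)"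
    using lower unfolding total[symmetric] by (intro antisym sum_mono[OF upper])
  have exact: "card (S i \<inter> V j) = k j - 1" if i: "i \<in> {1..q}" and j: "j \<in> {1..m}" for i j
  proof -
    have "(\<Sum>j\<in>{1..m}. card (S i \<inter> V j)) = (\<Sum>j\<in>{1..m}. k j - 1)"
      using sum_mono_inv[OF eq_total upper i] by simp
    then show ?thesis
      using sum_mono_inv[of "\<lambda>j. card (S i \<inter> V j)" "{1..m}" "\<lambda>j. k j - 1"] small i j by simp
  qed

  have left: "card (V j - (\<Union>i\<in>{1..q}. S i)) = q - 1" if j: "j \<in> {1..m}" for j
  proof -
    have "V j - (\<Union>i\<in>{1..q}. S i) = V j - (\<Union>i\<in>{1..q}. S i \<inter> V j)"
      by blast
    moreover have "card (V j - (\<Union>i\<in>{1..q}. S i \<inter> V j)) = card (V j) - card (\<Union>i\<in>{1..q}. S i \<inter> V j)"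
      by (intro card_Diff_subset) auto
    moreover have "card (\<Union>i\<in>{1..q}. S i \<inter> V j) = q * (k j - 1)"
      using card_UN[of "V j"] exact j by simp
    moreover obtain l where "k j = Suc l"
      using k j by (metis Suc_le_D One_nat_def)
    ultimately show ?thesis
      using card_parts j by simp
  qed
  \<comment> \<open>The quotient is an integer because \<open>card (V j) + 1 = q * k j\<close>, so
    the minimum required by fairness is the number \<open>k j - 1\<close> attained above.\<close>
  have floor: "\<lfloor>(real (card (V j)) + 1) / real q\<rfloor> = int (k j)" if j: "j \<in> {1..m}" for j
  proof -
    have "q * k j > 0"
      using q bspec[OF k j] by simp
    then have "real (card (V j)) + 1 = real q * real (k j)"
      using card_parts j by (simp add: of_nat_diff)
    then show ?thesis using q by simp
  qed
  have "almost_fair_splitting m V q S"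
    unfolding almost_fair_splitting_def
    using dis exact left floor q k by (auto simp: of_nat_diff)
  \<comment> \<open>All \<open>S i\<close> have the same cardinality, the sum of the
    \<open>k j - 1\<close>.\<close>
  moreover have "balanced_splitting q S"
    unfolding balanced_splitting_def using exact by (simp add: card_S)
  ultimately show ?thesis
    using indep by blast
qed

end
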